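(* Let $n$ be a positive integer, let $G$ be the complete bipartite graph $K_{n,n}$, and let $\mathcal{M}_S$ be a family of at most $3n/4$ perfect matchings of $G$ (different matchings in the family may share edges). Then there is a perfect matching of $G$ that is light and rainbow with respect to $\mathcal{M}_S$ and which contains a maximum sized $0$-light matching of $G$.
   Context: Each member of the family $\mathcal{M}_S$ is thought of as a colour: an edge of $G$ has as its colours the members of $\mathcal{M}_S$ containing it. A matching $M$ of $G$ is $k$-light with respect to $\mathcal{M}_S$ if no edge of $M$ lies in more than $k$ members of $\mathcal{M}_S$ (so $0$-light means every edge of $M$ lies in no member of $\mathcal{M}_S$), and $k$-rainbow if no member of $\mathcal{M}_S$ contains more than $k$ edges of $M$. Light means $1$-light and rainbow means $1$-rainbow. A maximum sized $0$-light matching is a $0$-light matching of $G$ of largest possible cardinality. *)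

theory Defs
  imports Complex_Main
begin

text \<open>A graph is a pair of a vertex set and a set of edges, an edge being the set of its
  two endpoints.\<close>

type_synonym 'a graph = "'a set \<times> 'a set set"

abbreviation verts :: "'a graph \<Rightarrow> 'a set" where
  "verts G \<equiv> fst G"

abbreviation edges :: "'a graph \<Rightarrow> 'a set set" where
  "edges G \<equiv> snd G"

definition is_complete_bipartite :: "nat \<Rightarrow> nat \<Rightarrow> 'a graph \<Rightarrow> bool" where
  "is_complete_bipartite m n G \<longleftrightarrow>
     (\<exists>A B. finite A \<and> finite B \<and> card A = m \<and> card B = n \<and> A \<inter> B = {} \<and>
            verts G = A \<union> B \<and> edges G = {{a, b} | a b. a \<in> A \<and> b \<in> B})"

definition matching :: "'a graph \<Rightarrow> 'a set set \<Rightarrow> bool" where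
  "matching G M \<longleftrightarrow> M \<subseteq> edges G \<and> (\<forall>e\<in>M. \<forall>f\<in>M. e \<noteq> f \<longrightarrow> e \<inter> f = {})"

definition perfect_matching :: "'a graph \<Rightarrow> 'a set set \<Rightarrow> bool" where
  "perfect_matching G M \<longleftrightarrow> matching G M \<and> \<Union>M = verts G"

text \<open>The family \<open>F\<close> below is a set of matchings. In a finite graph it is automatically
  finite, and so are the sets whose cardinalities are taken.\<close>

definition light :: "nat \<Rightarrow> 'a set set set \<Rightarrow> 'a set set \<Rightarrow> bool" where
  "light k F M \<longleftrightarrow> (\<forall>e\<in>M. card {N \<in> F. e \<in> N} \<le> k)"

definition rainbow :: "nat \<Rightarrow> 'a set set set \<Rightarrow> 'a set set \<Rightarrow> bool" where
  "rainbow k F M \<longleftrightarrow> (\<forall>N\<in>F. card (N \<inter> M) \<le> k)"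

definition max_zero_light_matching :: "'a graph \<Rightarrow> 'a set set set \<Rightarrow> 'a set set \<Rightarrow> bool" where
  "max_zero_light_matching G F M \<longleftrightarrow>
     matching G M \<and> light 0 F M \<and>
     (\<forall>M'. matching G M' \<and> light 0 F M' \<longrightarrow> card M' \<le> card M)"

end

theory Submission
  imports Defs
begin

text \<open>By Koenig's theorem the colourless edges have a vertex cover \<open>X \<union> Y\<close>, where \<open>X\<close> lies on
  the left and \<open>Y\<close> on the right, together with a matching that covers \<open>X \<union> Y\<close>; with \<open>P\<close> and \<open>Q\<close>
  the uncovered vertices of the two sides, such a matching leaves \<open>d = n - |X| - |Y|\<close> vertices free
  in each of \<open>P\<close> and \<open>Q\<close>. It remains to match the free vertices by a light rainbow matching \<open>R\<close>
  inside \<open>P \<times> Q\<close>, where the colourless matching may be changed along alternating paths. Let \<open>R\<close>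
  be as large as possible and suppose that the free vertices \<open>p\<close> and \<open>q\<close> are not covered by \<open>R\<close>.

  Let \<open>S\<close> and \<open>T\<close> be the sets of vertices that alternating paths can make free in place of \<open>p\<close> and
  \<open>q\<close>. Every edge of \<open>S \<times> T\<close> has two colours or a colour of \<open>R\<close>. As in Koksma's bound for
  transversals of Latin squares, an edge \<open>(x, q)\<close> with \<open>x \<in> S\<close> and a single colour can replace the
  edge \<open>(a, b)\<close> of \<open>R\<close> of that colour; this frees \<open>a\<close> and \<open>b\<close>, so the edges from \<open>a\<close> to the set
  \<open>T\<^sub>x\<close> of vertices that can be made free in place of \<open>b\<close> are restricted in the same way. A vertex in
  \<open>T\<close> has fewer than \<open>|T|\<close> colourless edges, hence few edges with two colours, so it cannot be in
  many of the sets \<open>T\<^sub>x\<close>. On the other hand each \<open>T\<^sub>x\<close> is large, and it meets \<open>T\<close> in many vertices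
  because \<open>|T \<union> T\<^sub>x| \<le> |X| + 2\<close>. Double counting over \<open>T - {q}\<close> gives a contradiction if
  \<open>|T| \<le> |S|\<close>, which may be assumed by symmetry.\<close>

section \<open>Alternating walks and exchange of free vertices\<close>

text \<open>\<open>D\<close> is what a matching of \<open>Y\<close> into \<open>P\<close> leaves
  free. The matching stays under the existential quantifier because later arguments only follow the
  free vertices.\<close>

definition saturates :: "('b \<Rightarrow> 'a \<Rightarrow> bool) \<Rightarrow> 'b set \<Rightarrow> 'a set \<Rightarrow> 'a set \<Rightarrow> bool" where
  "saturates E Y P D \<longleftrightarrow>
     D \<subseteq> P \<and> (\<exists>h. bij_betw h Y (P - D) \<and> (\<forall>y\<in>Y. E y (h y)))"

text \<open>Stands for the set reachable from \<open>p\<close> by alternating paths: each member can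
  become free in place of \<open>p\<close>. The last clause is a Hall violation; it will bound the
  number of colourless edges at members of the set.\<close>

definition exchange_set ::
    "('b \<Rightarrow> 'a \<Rightarrow> bool) \<Rightarrow> 'b set \<Rightarrow> 'a set \<Rightarrow> 'a set \<Rightarrow> 'a \<Rightarrow> 'a set \<Rightarrow> bool" where
  "exchange_set E Y P D p S \<longleftrightarrow>
     S \<subseteq> P \<and> S \<inter> D = {p} \<and> (\<forall>x\<in>S. saturates E Y P (insert x (D - {p}))) \<and>
     card {y \<in> Y. \<exists>x\<in>S. E y x} < card S"

text \<open>An edge from \<open>u\<close> to \<open>y\<close> followed by the matching edge at
  \<open>y\<close>, so that walks stay on one side.\<close>

definition alt_step :: "('b \<Rightarrow> 'a \<Rightarrow> bool) \<Rightarrow> ('b \<Rightarrow> 'a) \<Rightarrow> 'b set \<Rightarrow> 'a \<Rightarrow> 'a \<Rightarrow> bool" where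
  "alt_step E h Y u w \<longleftrightarrow> (\<exists>y\<in>Y. E y u \<and> w = h y)"

text \<open>Induction on \<open>Y\<close>: the first \<open>y\<close> on the walk is rematched to
  \<open>p\<close>, and the rest of the walk starts at \<open>h y\<close>, which is thereby free,
  and runs inside \<open>Y - {y}\<close>. Walks may repeat vertices, so the reflexive transitive
  closure suffices.\<close>

lemma alternating_walk_switch:
  assumes "finite Y" "inj_on h Y" "\<forall>y\<in>Y. E y (h y)" "p \<notin> h ` Y" "(alt_step E h Y)\<^sup>*\<^sup>* p x"
  shows "\<exists>h'. bij_betw h' Y (insert p (h ` Y) - {x}) \<and> (\<forall>y\<in>Y. E y (h' y))"
  using assms
proof (induction Y arbitrary: p rule: finite_psubset_induct)
  case (psubset Y)
  show ?case
  proof (cases "x = p")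
    case True
    then show ?thesis using psubset.prems by (auto simp: bij_betw_def)
  next
    case False
    \<comment> \<open>Cutting the walk at its last visit to the first vertex after \<open>p\<close>.\<close>
    have "x = p \<or> (\<exists>y\<in>Y. E y p \<and> (alt_step E h (Y - {y}))\<^sup>*\<^sup>* (h y) x)"
      using psubset.prems(4)
    proof (induction rule: rtranclp_induct)
      case base
      then show ?case by simp
    next
      case (step u w)
      from step.hyps(2) obtain z where z: "z \<in> Y" "E z u" "w = h z"
        by (auto simp: alt_step_def)
      from step.IH show ?case
      proof (elim disjE bexE conjE)
        assume "u = p"
        then show ?thesis using z by blast
      next
        fix y assume y: "y \<in> Y" "E y p" "(alt_step E h (Y - {y}))\<^sup>*\<^sup>* (h y) u"
        show ?thesis
        proof (cases "z = y")
          case True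
          then show ?thesis using y z by blast
        next
          case False
          then have "alt_step E h (Y - {y}) u w" using z by (auto simp: alt_step_def)
          then show ?thesis using y by (meson rtranclp.rtrancl_into_rtrancl)
        qed
      qed
    qed
    then obtain y where y: "y \<in> Y" "E y p" "(alt_step E h (Y - {y}))\<^sup>*\<^sup>* (h y) x"
      using False by blast
    have im: "insert (h y) (h ` (Y - {y})) = h ` Y" using y(1) by auto
    have "h y \<notin> h ` (Y - {y})" using psubset.prems(1) y(1) by (auto simp: inj_on_def)
    then have "\<exists>h'. bij_betw h' (Y - {y}) (insert (h y) (h ` (Y - {y})) - {x}) \<and>
        (\<forall>z\<in>Y - {y}. E z (h' z))"
      using psubset.prems(1,2) y by (intro psubset.IH) (auto simp: inj_on_def)
    then obtain h' where h': "bij_betw h' (Y - {y}) (h ` Y - {x})" "\<forall>z\<in>Y - {y}. E z (h' z)"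
      unfolding im by blast
    let ?g = "h'(y := p)"
    have "bij_betw ?g (Y - {y}) (h ` Y - {x})"
      using h'(1) by (subst bij_betw_cong[where g = h']) auto
    moreover have "p \<notin> h ` Y - {x}" using psubset.prems(3) by blast
    ultimately have "bij_betw ?g (Y - {y} \<union> {y}) ((h ` Y - {x}) \<union> {?g y})"
      by (intro notIn_Un_bij_betw) auto
    moreover have "Y - {y} \<union> {y} = Y" using y(1) by blast
    moreover have "(h ` Y - {x}) \<union> {?g y} = insert p (h ` Y) - {x}" using False by auto
    ultimately have "bij_betw ?g Y (insert p (h ` Y) - {x})" by simp
    moreover have "\<forall>z\<in>Y. E z (?g z)" using h'(2) y(2) by auto
    ultimately show ?thesis by blast
  qed
qed

lemma exchange_set_exists:
  assumes "saturates E Y P D" "p \<in> D" "finite P" "finite Y"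
  shows "\<exists>S. exchange_set E Y P D p S"
proof -
  obtain h where h: "bij_betw h Y (P - D)" "\<forall>y\<in>Y. E y (h y)" and DP: "D \<subseteq> P"
    using assms(1) by (auto simp: saturates_def)
  have inj: "inj_on h Y" and im: "h ` Y = P - D" using h(1) by (auto simp: bij_betw_def)
  define S where "S = {x. (alt_step E h Y)\<^sup>*\<^sup>* p x}"
  have pS: "p \<in> S" by (simp add: S_def)
  have S_cases: "x = p \<or> x \<in> P - D" if "x \<in> S" for x
    using that unfolding S_def mem_Collect_eq
    by (induction rule: rtranclp_induct) (use im in \<open>auto simp: alt_step_def\<close>)
  then have SP: "S \<subseteq> P" using assms(2) DP by blast
  have sat: "saturates E Y P (insert x (D - {p}))" if x: "x \<in> S" for x
  proof -
    have "\<exists>h'. bij_betw h' Y (insert p (h ` Y) - {x}) \<and> (\<forall>y\<in>Y. E y (h' y))"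
      using x im assms(2,4) inj h(2) by (intro alternating_walk_switch) (auto simp: S_def)
    moreover have "insert p (h ` Y) - {x} = P - insert x (D - {p})"
      using im assms(2) DP by auto
    ultimately show ?thesis using x SP DP by (auto simp: saturates_def)
  qed
  let ?N = "{y \<in> Y. \<exists>x\<in>S. E y x}"
  \<comment> \<open>Reachability is closed under steps, so neighbours of \<open>S\<close> have their
    partners in \<open>S\<close>. The free vertex \<open>p\<close> is nobody's partner, which makes
    the bound strict.\<close>
  have "h ` ?N \<subseteq> S - {p}"
  proof
    fix w assume "w \<in> h ` ?N"
    then obtain y x where y: "y \<in> Y" "x \<in> S" "E y x" "w = h y" by blast
    then have "alt_step E h Y x w" by (auto simp: alt_step_def)
    then have "w \<in> S" using y(2) unfolding S_def by auto
    moreover have "w \<noteq> p" using im y assms(2) by auto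
    ultimately show "w \<in> S - {p}" by blast
  qed
  moreover have fS: "finite S" using SP assms(3) finite_subset by blast
  ultimately have "card (h ` ?N) \<le> card (S - {p})" by (intro card_mono) auto
  moreover have "card (h ` ?N) = card ?N" using inj by (intro card_image) (auto simp: inj_on_def)
  moreover have "card (S - {p}) < card S" using fS pS by (rule card_Diff1_less)
  ultimately have "card ?N < card S" by linarith
  moreover have "S \<inter> D = {p}" using S_cases pS assms(2) by blast
  ultimately show ?thesis using SP sat unfolding exchange_set_def by blast
qed

lemma saturates_card:
  assumes "saturates E Y P D" "finite P"
  shows "card P = card Y + card D"
proof -
  obtain h where "bij_betw h Y (P - D)" "D \<subseteq> P" using assms(1) by (auto simp: saturates_def)
  then have "card Y = card P - card D" "card D \<le> card P"
    using assms(2) by (auto simp: bij_betw_same_card card_Diff_subset finite_subset card_mono)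
  then show ?thesis by linarith
qed

section \<open>Arithmetic of the double count\<close>

text \<open>Here \<open>D\<close> is one more than the guaranteed colourless degree, \<open>|S| = D + \<sigma>\<close>, \<open>|T| = D + \<tau>\<close>, \<open>i\<close>
  counts the replacing edges, \<open>L\<close> bounds \<open>|T \<inter> T\<^sub>x|\<close> from below, and \<open>K\<close> bounds from above the
  number of sets \<open>T\<^sub>x\<close> through a vertex of \<open>T\<close>.\<close>

lemma counting_contradiction:
  fixes D \<sigma> \<tau> K L i :: int
  assumes "1 \<le> D" "0 \<le> \<tau>" "\<tau> \<le> \<sigma>" "0 \<le> K" "K + 2 + 2 * \<sigma> \<le> L" "L \<le> D - 1"
    and "D + \<sigma> - \<tau> \<le> i" and upper: "i * L \<le> (D + \<tau> - 1) * K"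
  shows False
proof -
  have "(D + \<sigma> - \<tau>) * (K + 2 + 2 * \<sigma>) \<le> i * L"
    using assms by (intro mult_mono) auto
  \<comment> \<open>Cancelling multiples of \<open>K\<close> leaves the factor 2\<tau> - \<sigma> -
    1, at most \<sigma> because \<tau> \<le> \<sigma>. As \<open>K\<close> is below
    \<open>D\<close>, the right side is then at most \<open>D\<close> times \<sigma>, too small for
    the left side.\<close>
  then have *: "(D + \<sigma> - \<tau>) * (2 + 2 * \<sigma>) \<le> K * (2 * \<tau> - \<sigma> - 1)"
    using upper by (simp add: algebra_simps)
  have "D * (2 + 2 * \<sigma>) \<le> (D + \<sigma> - \<tau>) * (2 + 2 * \<sigma>)"
    using assms by (intro mult_right_mono) auto
  moreover have "K * (2 * \<tau> - \<sigma> - 1) \<le> K * \<sigma>" using assms by (intro mult_left_mono) auto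
  moreover have "K * \<sigma> \<le> D * \<sigma>" using assms by (intro mult_right_mono) auto
  moreover have "D * \<sigma> < D * (2 + 2 * \<sigma>)" using assms by (intro mult_strict_left_mono) auto
  ultimately show False using * by linarith
qed

section \<open>Koenig's theorem\<close>

text \<open>For a maximum matching \<open>h\<close>, let \<open>P\<close> be reached by alternating
  walks from the unmatched vertices of \<open>A\<close>, and let \<open>Y\<close> be the neighbours
  of \<open>P\<close>. Then \<open>A - P\<close> and \<open>Y\<close> form a cover, and the two
  saturating matchings are parts of \<open>h\<close>.\<close>

lemma koenig_cover:
  assumes "finite A" "finite B"
  shows "\<exists>P Y. P \<subseteq> A \<and> Y \<subseteq> B \<and> (\<forall>a\<in>P. \<forall>b\<in>B - Y. \<not> E b a) \<and>
    (\<exists>D. saturates E Y P D) \<and> (\<exists>D. saturates (\<lambda>a b. E b a) (A - P) (B - Y) D)"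
proof -
  define good where "good Z \<longleftrightarrow>
    Z \<subseteq> B \<and> (\<exists>h. inj_on h Z \<and> h ` Z \<subseteq> A \<and> (\<forall>z\<in>Z. E z (h z)))" for Z
  have "good {}" by (simp add: good_def)
  moreover have "\<forall>Z. good Z \<longrightarrow> card Z < Suc (card B)"
    using assms(2) by (auto simp: good_def less_Suc_eq_le intro: card_mono)
  ultimately have "\<exists>Z. good Z \<and> (\<forall>Z'. good Z' \<longrightarrow> card Z' \<le> card Z)"
    by (rule Lattices_Big.ex_has_greatest_nat)
  then obtain Z where Z: "good Z" and max: "\<forall>Z'. good Z' \<longrightarrow> card Z' \<le> card Z"
    by (elim exE conjE)
  obtain h where h: "inj_on h Z" "h ` Z \<subseteq> A" "\<forall>z\<in>Z. E z (h z)" and ZB: "Z \<subseteq> B"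
    using Z by (auto simp: good_def)
  have fZ: "finite Z" using ZB assms(2) finite_subset by blast
  define P where "P = {u. \<exists>p\<in>A - h ` Z. (alt_step E h Z)\<^sup>*\<^sup>* p u}"
  define Y where "Y = {b \<in> B. \<exists>u\<in>P. E b u}"
  have free_P: "A - h ` Z \<subseteq> P" by (auto simp: P_def)
  have PA: "P \<subseteq> A"
  proof
    fix u assume "u \<in> P"
    then obtain p where p: "p \<in> A" "(alt_step E h Z)\<^sup>*\<^sup>* p u" by (auto simp: P_def)
    from p(2,1) h(2) show "u \<in> A"
      by (induction rule: rtranclp_induct) (auto simp: alt_step_def)
  qed
  \<comment> \<open>An unmatched neighbour \<open>b\<close> of \<open>u\<close> in \<open>P\<close>
    would give an augmenting walk: switching frees \<open>u\<close>, which can then be matched to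
    \<open>b\<close>.\<close>
  have YZ: "Y \<subseteq> Z"
  proof (rule ccontr)
    assume "\<not> Y \<subseteq> Z"
    then obtain b u p where b: "b \<in> B" "b \<notin> Z" "E b u" "u \<in> P"
      and p: "p \<in> A" "p \<notin> h ` Z" "(alt_step E h Z)\<^sup>*\<^sup>* p u" by (auto simp: Y_def P_def)
    from alternating_walk_switch[OF fZ h(1,3) p(2,3)] obtain h' where
      h': "bij_betw h' Z (insert p (h ` Z) - {u})" "\<forall>z\<in>Z. E z (h' z)" by blast
    let ?g = "h'(b := u)"
    have im: "?g ` Z = insert p (h ` Z) - {u}" and inj: "inj_on ?g Z"
      using h'(1) b(2) by (auto simp: bij_betw_def inj_on_def)
    have "good (insert b Z)" unfolding good_def
    proof (intro conjI exI[of _ ?g])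
      show "inj_on ?g (insert b Z)" using inj im b(2) by simp
      show "?g ` insert b Z \<subseteq> A" using im PA b(4) h(2) p(1) by (subst image_insert) auto
      show "\<forall>z\<in>insert b Z. E z (?g z)" using h'(2) b(3) by auto
    qed (use ZB b in auto)
    then show False using max fZ b(2) by (metis card_insert_disjoint not_less_eq_eq order_refl)
  qed
  \<comment> \<open>A vertex of \<open>P\<close> is either unmatched or entered through its partner,
    which lies in \<open>Y\<close>.\<close>
  have hY: "h ` Y = P - (A - h ` Z)"
  proof (intro subset_antisym subsetI)
    fix w assume "w \<in> h ` Y"
    then obtain y u where y: "y \<in> Z" "u \<in> P" "E y u" "w = h y" using YZ by (auto simp: Y_def)
    then obtain p where "p \<in> A - h ` Z" "(alt_step E h Z)\<^sup>*\<^sup>* p u" by (auto simp: P_def)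
    moreover have "alt_step E h Z u w" using y by (auto simp: alt_step_def)
    ultimately have "w \<in> P" unfolding P_def by (blast intro: rtranclp.rtrancl_into_rtrancl)
    then show "w \<in> P - (A - h ` Z)" using y by blast
  next
    fix w assume "w \<in> P - (A - h ` Z)"
    then obtain p where p: "p \<in> A - h ` Z" "(alt_step E h Z)\<^sup>*\<^sup>* p w" "w \<noteq> p"
      by (auto simp: P_def)
    then obtain u where u: "(alt_step E h Z)\<^sup>*\<^sup>* p u" "alt_step E h Z u w"
      by (metis rtranclp.cases)
    then have "u \<in> P" using p by (auto simp: P_def)
    then show "w \<in> h ` Y" using u ZB by (auto simp: alt_step_def Y_def)
  qed
  have satP: "saturates E Y P (A - h ` Z)" unfolding saturates_def bij_betw_def
    using free_P hY h(3) YZ inj_on_subset[OF h(1) YZ] by (intro conjI exI[of _ h]) auto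
  \<comment> \<open>The rest of the matching is read backwards, from \<open>A - P\<close> to
    \<open>Z - Y\<close>.\<close>
  have satQ: "saturates (\<lambda>a b. E b a) (A - P) (B - Y) (B - Z)" unfolding saturates_def
  proof (intro conjI exI[of _ "the_inv_into Z h"])
    have "h ` (Z - Y) = h ` Z - h ` Y"
      using h(1) YZ by (intro inj_on_image_set_diff[of h Z]) auto
    moreover have "S - (P - (A - S)) = A - P" if "S \<subseteq> A" "A - S \<subseteq> P" "P \<subseteq> A" for S
      using that by blast
    ultimately have im: "h ` (Z - Y) = A - P" using hY h(2) free_P PA by metis
    have "bij_betw h (Z - Y) (A - P)"
      using im h(1) by (auto simp: bij_betw_def intro: inj_on_subset)
    then have "the_inv_into Z h ` (A - P) = Z - Y"
      unfolding im[symmetric] using h(1) by (auto simp: image_image the_inv_into_f_f)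
    moreover have "inj_on (the_inv_into Z h) (A - P)"
      using inj_on_the_inv_into[OF h(1)] by (rule inj_on_subset) (use im in auto)
    moreover have "B - Y - (B - Z) = Z - Y" using ZB by blast
    ultimately show "bij_betw (the_inv_into Z h) (A - P) (B - Y - (B - Z))"
      by (simp add: bij_betw_def)
    show "\<forall>a\<in>A - P. E (the_inv_into Z h a) a"
      unfolding im[symmetric] using h(1,3) by (auto simp: the_inv_into_f_f)
  qed (use YZ in auto)
  have no_edge: "\<forall>a\<in>P. \<forall>b\<in>B - Y. \<not> E b a" by (auto simp: Y_def)
  have YB: "Y \<subseteq> B" by (auto simp: Y_def)
  show ?thesis
    by (rule exI[of _ P], rule exI[of _ Y])
      (intro conjI PA YB no_edge exI[of _ "A - h ` Z"] exI[of _ "B - Z"] satP satQ)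
qed

section \<open>Light rainbow matchings away from the cover\<close>

text \<open>\<open>X \<union> Y\<close> is a vertex cover of the graph of colourless edges, \<open>X\<close> on the left and \<open>Y\<close>
  on the right; \<open>P\<close> and \<open>Q\<close> are the uncovered vertices of the two sides.\<close>

locale covered_colouring =
  fixes P X :: "'a set" and Q Y :: "'b set" and C :: "'a \<Rightarrow> 'b \<Rightarrow> 'c set"
    and F :: "'c set" and n :: nat
  assumes fin: "finite P" "finite X" "finite Q" "finite Y" "finite F"
    and disj: "P \<inter> X = {}" "Q \<inter> Y = {}"
    and sides: "card (P \<union> X) = n" "card (Q \<union> Y) = n"
    and n_pos: "n > 0"
    and few_colours: "4 * card F \<le> 3 * n"
    and C_subset: "C a b \<subseteq> F"
    and ex1_right: "a \<in> P \<union> X \<Longrightarrow> c \<in> F \<Longrightarrow> \<exists>!b. b \<in> Q \<union> Y \<and> c \<in> C a b"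
    and ex1_left: "b \<in> Q \<union> Y \<Longrightarrow> c \<in> F \<Longrightarrow> \<exists>!a. a \<in> P \<union> X \<and> c \<in> C a b"
    and cover: "a \<in> P \<Longrightarrow> b \<in> Q \<Longrightarrow> C a b \<noteq> {}"
begin

lemma finite_C [simp]: "finite (C a b)"
  using C_subset fin(5) finite_subset by blast

lemma unique_left:
  assumes b: "b \<in> Q \<union> Y" and "a \<in> P \<union> X" "a' \<in> P \<union> X" "c \<in> C a b" "c \<in> C a' b"
  shows "a = a'"
proof -
  have "c \<in> F" using assms(4) by (rule subsetD[OF C_subset])
  from ex1_left[OF b this] obtain z where "\<forall>w. w \<in> P \<union> X \<and> c \<in> C w b \<longrightarrow> w = z"
    by (elim ex1E)
  then show ?thesis using assms(2-5) by (metis (no_types))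
qed

text \<open>Exactly one colour is demanded, since \<open>cover\<close> excludes colourless edges
  between \<open>P\<close> and \<open>Q\<close>. Ordered pairs keep the two sides apart.\<close>

definition light_rainbow :: "('a \<times> 'b) set \<Rightarrow> bool" where
  "light_rainbow R \<longleftrightarrow> R \<subseteq> P \<times> Q \<and> inj_on fst R \<and> inj_on snd R \<and>
     (\<forall>(a, b)\<in>R. card (C a b) = 1) \<and>
     (\<forall>(a, b)\<in>R. \<forall>(a', b')\<in>R. C a b \<inter> C a' b' \<noteq> {} \<longrightarrow> (a, b) = (a', b'))"

abbreviation "freeP \<equiv> saturates (\<lambda>y a. C a y = {}) Y P"
abbreviation "freeQ \<equiv> saturates (\<lambda>x b. C x b = {}) X Q"

text \<open>Maximality of \<open>R\<close> will range over all \<open>DP\<close> and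
  \<open>DQ\<close> as well; this is what permits changing the colourless matching along alternating
  paths.\<close>

definition config :: "'a set \<Rightarrow> 'b set \<Rightarrow> ('a \<times> 'b) set \<Rightarrow> bool" where
  "config DP DQ R \<longleftrightarrow> light_rainbow R \<and> freeP DP \<and> freeQ DQ \<and> fst ` R \<subseteq> DP \<and> snd ` R \<subseteq> DQ"

definition colours :: "('a \<times> 'b) set \<Rightarrow> 'c set" where
  "colours R = (\<Union>(a, b)\<in>R. C a b)"

lemma finite_light_rainbow: "light_rainbow R \<Longrightarrow> finite R"
  using fin finite_subset[of R "P \<times> Q"] by (auto simp: light_rainbow_def)

lemma card_colours:
  assumes "light_rainbow R" shows "card (colours R) = card R"
proof -
  have "card (colours R) = (\<Sum>e\<in>R. card (case e of (a, b) \<Rightarrow> C a b))"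
    unfolding colours_def
  proof (rule card_UN_disjoint)
    show "finite R" using assms by (rule finite_light_rainbow)
    show "\<forall>e\<in>R. finite (case e of (a, b) \<Rightarrow> C a b)" by auto
    show "\<forall>e\<in>R. \<forall>e'\<in>R. e \<noteq> e' \<longrightarrow>
        (case e of (a, b) \<Rightarrow> C a b) \<inter> (case e' of (a, b) \<Rightarrow> C a b) = {}"
      using assms unfolding light_rainbow_def by fast
  qed
  also have "\<dots> = (\<Sum>e\<in>R. 1)" using assms by (intro sum.cong) (auto simp: light_rainbow_def)
  finally show ?thesis by simp
qed

lemma light_rainbow_insert:
  assumes "light_rainbow R" "a \<in> P" "b \<in> Q" "a \<notin> fst ` R" "b \<notin> snd ` R" "C a b = {c}"
    "c \<notin> colours R"
  shows "light_rainbow (insert (a, b) R)"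
proof -
  have disj: "C a b \<inter> C a' b' = {}" if "(a', b') \<in> R" for a' b'
    using that assms(6,7) by (auto simp: colours_def)
  have "\<forall>(u, v)\<in>insert (a, b) R. \<forall>(u', v')\<in>insert (a, b) R.
      C u v \<inter> C u' v' \<noteq> {} \<longrightarrow> (u, v) = (u', v')"
  proof (clarify)
    fix u v u' v' assume "(u, v) \<in> insert (a, b) R" "(u', v') \<in> insert (a, b) R"
      and ne: "C u v \<inter> C u' v' \<noteq> {}"
    then consider "(u, v) = (a, b)" "(u', v') = (a, b)" | "(u, v) = (a, b)" "(u', v') \<in> R"
      | "(u, v) \<in> R" "(u', v') = (a, b)" | "(u, v) \<in> R" "(u', v') \<in> R" by blast
    then show "u = u' \<and> v = v'"
    proof cases
      case 4
      then show ?thesis using assms(1) ne unfolding light_rainbow_def by fast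
    qed (use disj ne in \<open>auto simp: Int_commute\<close>)
  qed
  moreover have "inj_on fst (insert (a, b) R)" "inj_on snd (insert (a, b) R)"
    using assms(1,4,5) by (auto simp: light_rainbow_def)
  ultimately show ?thesis using assms unfolding light_rainbow_def by auto
qed

lemma light_rainbow_mono: "light_rainbow R \<Longrightarrow> R' \<subseteq> R \<Longrightarrow> light_rainbow R'"
  unfolding light_rainbow_def by (auto intro: inj_on_subset; blast)

section \<open>Obstructions in a maximal configuration\<close>

text \<open>Otherwise, since \<open>cover\<close> forbids colourless edges here,
  \<open>(a, b)\<close> has a single colour, new to \<open>R\<close>, and could be added.\<close>

lemma maximal_config_blocked:
  assumes "config DP DQ R" "a \<in> DP - fst ` R" "b \<in> DQ - snd ` R"
    and max: "\<And>DP' DQ' R'. config DP' DQ' R' \<Longrightarrow> card R' \<le> card R"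
  shows "2 \<le> card (C a b) \<or> (\<exists>c\<in>colours R. C a b = {c})"
proof (rule ccontr)
  assume neg: "\<not> ?thesis"
  have ab: "a \<in> P" "b \<in> Q" using assms(1-3) by (auto simp: config_def saturates_def)
  have "card (C a b) \<noteq> 0" using cover[OF ab] by simp
  then have "card (C a b) = 1" using neg by linarith
  then obtain c where c: "C a b = {c}" by (auto simp: card_Suc_eq)
  have R: "light_rainbow R" using assms(1) by (simp add: config_def)
  have "light_rainbow (insert (a, b) R)"
    using neg c assms(2,3) ab R by (intro light_rainbow_insert) auto
  then have "config DP DQ (insert (a, b) R)" using assms(1-3) by (auto simp: config_def)
  then have "card (insert (a, b) R) \<le> card R" by (rule max)
  moreover have "(a, b) \<notin> R" using assms(2) by force
  ultimately show False using finite_light_rainbow[OF R] by simp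
qed

text \<open>Every colour occurs exactly once at \<open>b\<close>, so its \<open>n\<close> edges
  carry \<open>card F\<close> colours in total. Each edge with two or more colours exceeds the
  average budget of one, and only colourless edges make up for it.\<close>

lemma multi_bound:
  assumes "b \<in> Q \<union> Y"
  shows "card {a \<in> P \<union> X. 2 \<le> card (C a b)} + n \<le> card F + card {a \<in> P \<union> X. C a b = {}}"
proof -
  let ?A = "P \<union> X"
  have fA: "finite ?A" using fin by simp
  have "F = (\<Union>a\<in>?A. C a b)"
  proof
    show "F \<subseteq> (\<Union>a\<in>?A. C a b)"
      using ex1_left[OF assms] by (meson UN_iff ex1_implies_ex subsetI)
    show "(\<Union>a\<in>?A. C a b) \<subseteq> F" using C_subset by (meson UN_least)
  qed
  moreover have "card (\<Union>a\<in>?A. C a b) = (\<Sum>a\<in>?A. card (C a b))"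
  proof (rule card_UN_disjoint[OF fA])
    show "\<forall>i\<in>?A. \<forall>j\<in>?A. i \<noteq> j \<longrightarrow> C i b \<inter> C j b = {}"
    proof (intro ballI impI)
      fix i j assume ij: "i \<in> ?A" "j \<in> ?A" "i \<noteq> j"
      have False if "c \<in> C i b" "c \<in> C j b" for c
        using unique_left[OF assms ij(1,2) that] ij(3) by contradiction
      then show "C i b \<inter> C j b = {}" by (meson disjoint_iff)
    qed
  qed simp
  ultimately have F: "card F = (\<Sum>a\<in>?A. card (C a b))" by simp
  have "card {a \<in> ?A. 2 \<le> card (C a b)} + card ?A =
      (\<Sum>a\<in>?A. of_bool (2 \<le> card (C a b)) + 1)"
    using fA by (simp only: sum.distrib sum_of_bool_eq) (simp add: Int_def)
  also have "\<dots> \<le> (\<Sum>a\<in>?A. card (C a b) + of_bool (C a b = {}))"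
  proof (rule sum_mono)
    fix a
    show "of_bool (2 \<le> card (C a b)) + 1 \<le> card (C a b) + of_bool (C a b = {})"
      by (cases "C a b = {}") (auto simp: Suc_le_eq card_gt_0_iff)
  qed
  also have "\<dots> = card F + card {a \<in> ?A. C a b = {}}"
    using fA by (simp only: sum.distrib sum_of_bool_eq F) (simp add: Int_def)
  finally show ?thesis using sides by simp
qed

text \<open>By \<open>cover\<close>, colourless edges at \<open>b\<close> end in \<open>X\<close>,
  hence at neighbours of \<open>T\<close>, of which there are fewer than
  \<open>card T\<close>.\<close>

lemma exchange_multi_bound:
  assumes "exchange_set (\<lambda>x b. C x b = {}) X Q D q T" "b \<in> T"
  shows "card {a \<in> P \<union> X. 2 \<le> card (C a b)} + n < card F + card T"
proof -
  have b: "b \<in> Q" using assms by (auto simp: exchange_set_def)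
  have "{a \<in> P \<union> X. C a b = {}} \<subseteq> {x \<in> X. \<exists>b\<in>T. C x b = {}}" using cover b assms(2) by blast
  then have "card {a \<in> P \<union> X. C a b = {}} \<le> card {x \<in> X. \<exists>b\<in>T. C x b = {}}"
    using fin by (intro card_mono) auto
  also have "\<dots> < card T" using assms(1) by (simp add: exchange_set_def)
  finally show ?thesis using multi_bound[of b] b by simp
qed

text \<open>With \<open>x\<close> free in place of \<open>p\<close>, the single colour of
  \<open>(x, q)\<close> must occur on some \<open>(a, b)\<close> in \<open>R\<close>. Exchanging
  these edges preserves the size and the colours of \<open>R\<close> and frees \<open>a\<close> and
  \<open>b\<close>, so the new configuration is maximal too.\<close>

lemma config_swap:
  assumes cfg: "config DP DQ R" and max: "\<And>DP' DQ' R'. config DP' DQ' R' \<Longrightarrow> card R' \<le> card R"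
    and p: "p \<in> DP - fst ` R" and q: "q \<in> DQ - snd ` R"
    and S: "exchange_set (\<lambda>y a. C a y = {}) Y P DP p S"
    and x: "x \<in> S" "card (C x q) = 1"
  shows "\<exists>a b T. (a, b) \<in> R \<and> C a b = C x q \<and> exchange_set (\<lambda>x b. C x b = {}) X Q DQ b T \<and>
    (\<forall>b'\<in>T. 2 \<le> card (C a b') \<or> (\<exists>c\<in>colours R. C a b' = {c}))"
proof -
  let ?DP = "insert x (DP - {p})"
  have R: "light_rainbow R" and fR: "fst ` R \<subseteq> DP" "snd ` R \<subseteq> DQ" and DQ: "freeQ DQ" "DQ \<subseteq> Q"
    using cfg by (auto simp: config_def saturates_def)
  have xP: "x \<in> P" and SDP: "S \<inter> DP = {p}" and DP: "freeP ?DP"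
    using S x by (auto simp: exchange_set_def)
  have x_fR: "x \<notin> fst ` R" using SDP x(1) fR(1) p by (metis Diff_iff IntI singletonD subsetD)
  have "config ?DP DQ R" using R DP DQ fR p by (auto simp: config_def)
  then have "2 \<le> card (C x q) \<or> (\<exists>c\<in>colours R. C x q = {c})"
    using x_fR q max by (intro maximal_config_blocked) auto
  then obtain c where c: "c \<in> colours R" "C x q = {c}" using x(2) by auto
  then obtain a b where ab: "(a, b) \<in> R" "c \<in> C a b" by (auto simp: colours_def)
  have "card (C a b) = 1" using R ab(1) by (auto simp: light_rainbow_def)
  then have Cab: "C a b = {c}" using ab(2) by (auto simp: card_1_singleton_iff)
  let ?Rest = "R - {(a, b)}"
  let ?R = "insert (x, q) ?Rest"
  have c0: "c \<notin> colours ?Rest" using R ab unfolding light_rainbow_def colours_def by fast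
  have R': "light_rainbow ?R"
    using light_rainbow_mono[OF R, of ?Rest] xP q DQ(2) x_fR c c0 by (intro light_rainbow_insert) auto
  have colours': "colours ?R = colours R" using ab c Cab by (auto simp: colours_def)
  have card': "card ?R = card R" using card_colours[OF R] card_colours[OF R'] colours' by simp
  have a: "a \<in> ?DP" "a \<noteq> x" using fR ab(1) p x_fR by force+
  have R_inj: "inj_on fst R" "inj_on snd R" using R by (simp_all add: light_rainbow_def)
  have rest: "fst ` ?Rest = fst ` R - {a}" "snd ` ?Rest = snd ` R - {b}"
    using R_inj ab(1) inj_on_image_set_diff[of fst R R "{(a, b)}"]
      inj_on_image_set_diff[of snd R R "{(a, b)}"] by simp_all
  have a0: "a \<notin> fst ` ?R" using rest(1) a(2) by simp
  have b: "b \<in> DQ" "b \<noteq> q" using fR ab(1) q by force+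
  have b0: "b \<notin> snd ` ?R" using rest(2) b(2) by simp
  have fst': "fst ` ?R \<subseteq> ?DP" using fR p by force
  have snd': "snd ` ?R \<subseteq> DQ" using fR q by force
  obtain T where T: "exchange_set (\<lambda>x b. C x b = {}) X Q DQ b T"
    using exchange_set_exists[OF DQ(1) b(1)] fin by blast
  have "2 \<le> card (C a b') \<or> (\<exists>c\<in>colours R. C a b' = {c})" if b': "b' \<in> T" for b'
  proof -
    \<comment> \<open>Since \<open>b\<close> is no longer covered by the new matching, the
      colourless matching may be switched to free \<open>b'\<close> in its place.\<close>
    have "config ?DP (insert b' (DQ - {b})) ?R"
    proof -
      have "snd ` ?R \<subseteq> insert b' (DQ - {b})" 
        using snd' b0 by (intro subset_insertI2) (simp only: subset_Diff_insert Diff_empty simp_thms)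
      then show ?thesis using R' DP T b' fst' by (simp add: config_def exchange_set_def)
    qed
    moreover have "b' \<notin> snd ` ?R"
    proof
      assume "b' \<in> snd ` ?R"
      moreover from this have "b' \<in> DQ" using snd' by (rule rev_subsetD)
      ultimately show False using T b' b0 by (metis IntI exchange_set_def singletonD)
    qed
    ultimately have "2 \<le> card (C a b') \<or> (\<exists>c\<in>colours ?R. C a b' = {c})"
      using a a0 max card' by (intro maximal_config_blocked) auto
    then show ?thesis by (simp only: colours')
  qed
  then show ?thesis using ab(1) Cab c(2) T by blast
qed

text \<open>A colour occurs only once at \<open>b\<close>, so at most \<open>card R\<close> vertices
  are blocked by a single colour of \<open>R\<close>.\<close>

lemma column_bound:
  assumes "b \<in> Q \<union> Y" "light_rainbow R" "W \<subseteq> P \<union> X"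
    and blocked: "\<And>a. a \<in> W \<Longrightarrow> 2 \<le> card (C a b) \<or> (\<exists>c\<in>colours R. C a b = {c})"
  shows "card W \<le> card {a \<in> P \<union> X. 2 \<le> card (C a b)} + card R"
proof -
  let ?M = "{a \<in> P \<union> X. 2 \<le> card (C a b)}" and ?N = "{a \<in> W. \<exists>c\<in>colours R. C a b = {c}}"
  have "finite W" using assms(3) fin finite_subset by blast
  moreover have "W \<subseteq> ?M \<union> ?N" using blocked assms(3) by blast
  ultimately have "card W \<le> card (?M \<union> ?N)" using fin by (intro card_mono) auto
  also have "\<dots> \<le> card ?M + card ?N" by (rule card_Un_le)
  also have "card ?N \<le> card (colours R)"
  proof (rule card_inj_on_le)
    show "inj_on (\<lambda>a. the_elem (C a b)) ?N"
    proof (rule inj_onI, clarsimp)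
      fix a a' c assume "a \<in> W" "a' \<in> W" "C a b = {c}" "C a' b = {c}"
      then show "a = a'" using assms(3) by (intro unique_left[OF assms(1), of a a' c]) auto
    qed
    show "(\<lambda>a. the_elem (C a b)) ` ?N \<subseteq> colours R" by auto
    show "finite (colours R)" using finite_light_rainbow[OF assms(2)] by (auto simp: colours_def)
  qed
  finally show ?thesis using card_colours[OF assms(2)] by simp
qed

section \<open>Double counting against a deficient configuration\<close>

lemma no_maximal_config_aux:
  assumes cfg: "config DP DQ R" and max: "\<And>DP' DQ' R'. config DP' DQ' R' \<Longrightarrow> card R' \<le> card R"
    and p: "p \<in> DP - fst ` R" and q: "q \<in> DQ - snd ` R"
    and S: "exchange_set (\<lambda>y a. C a y = {}) Y P DP p S"
    and T: "exchange_set (\<lambda>x b. C x b = {}) X Q DQ q T"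
    and le: "card T \<le> card S"
  shows False
proof -
  let ?ex = "exchange_set (\<lambda>x b. C x b = {}) X Q DQ"
  let ?ok = "\<lambda>a b. 2 \<le> card (C a b) \<or> (\<exists>c\<in>colours R. C a b = {c})"
  have R: "light_rainbow R" and fR: "fst ` R \<subseteq> DP" "snd ` R \<subseteq> DQ"
    and free: "freeP DP" "freeQ DQ" and sub: "DP \<subseteq> P" "DQ \<subseteq> Q"
    using cfg by (auto simp: config_def saturates_def)
  have SP: "S \<subseteq> P" "S \<inter> DP = {p}" and TQ: "T \<subseteq> Q" "T \<inter> DQ = {q}"
    using S T by (auto simp: exchange_set_def)
  have fS: "finite S" and fT: "finite T" using SP TQ fin finite_subset by blast+
  have fD: "finite DP" "finite DQ" using sub fin finite_subset by blast+

  define I where "I = {x \<in> S. card (C x q) = 1}"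
  have fI: "finite I" using fS by (simp add: I_def)
  \<comment> \<open>\<open>e x\<close> is the edge of \<open>R\<close> replaced by
    \<open>(x, q)\<close>, and \<open>V x\<close> is the exchange set of its right end.\<close>
  have "\<forall>x\<in>I. \<exists>e. e \<in> R \<and> C (fst e) (snd e) = C x q \<and>
      (\<exists>V. ?ex (snd e) V \<and> (\<forall>b\<in>V. ?ok (fst e) b))"
    using config_swap[OF cfg max p q S] unfolding I_def by (auto 0 4)
  then obtain e where e: "\<forall>x\<in>I. e x \<in> R \<and> C (fst (e x)) (snd (e x)) = C x q \<and>
      (\<exists>V. ?ex (snd (e x)) V \<and> (\<forall>b\<in>V. ?ok (fst (e x)) b))"
    by metis
  then obtain V where V: "\<And>x. x \<in> I \<Longrightarrow> ?ex (snd (e x)) (V x)"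
      "\<And>x b. x \<in> I \<Longrightarrow> b \<in> V x \<Longrightarrow> ?ok (fst (e x)) b"
    by metis
  define \<alpha> where "\<alpha> = (\<lambda>x. fst (e x))"
  have \<alpha>D: "\<alpha> x \<in> DP - {p}" if "x \<in> I" for x
  proof -
    have "\<alpha> x \<in> fst ` R" using e that by (simp add: \<alpha>_def)
    then show ?thesis using fR(1) p by (metis DiffI Diff_iff singletonD subsetD)
  qed
  \<comment> \<open>A left end determines its edge of \<open>R\<close>, hence the colour of
    \<open>(x, q)\<close>, and this colour occurs once at \<open>q\<close>.\<close>
  have \<alpha>_inj: "inj_on \<alpha> I"
  proof (rule inj_onI)
    fix x x' assume x: "x \<in> I" "x' \<in> I" "\<alpha> x = \<alpha> x'"
    then have "e x = e x'" using e R unfolding light_rainbow_def inj_on_def \<alpha>_def by blast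
    then have "C x q = C x' q" using e x by metis
    moreover obtain c where "C x q = {c}" using x(1) by (auto simp: I_def card_1_singleton_iff)
    ultimately show "x = x'"
      using x SP q sub by (intro unique_left[of q x x' c]) (auto simp: I_def)
  qed

  \<comment> \<open>The two sides can be switched independently.\<close>
  have blockedS: "?ok x b" if "x \<in> S" "b \<in> T" for x b
  proof -
    have "config (insert x (DP - {p})) (insert b (DQ - {q})) R"
    proof -
      have "fst ` R \<subseteq> insert x (DP - {p})" "snd ` R \<subseteq> insert b (DQ - {q})"
        using fR p q by (auto simp del: image_subset_iff)
      then show ?thesis using R S T that by (simp add: config_def exchange_set_def)
    qed
    then show ?thesis
    proof (rule maximal_config_blocked)
      show "x \<in> insert x (DP - {p}) - fst ` R"
        using that SP(2) fR(1) p by (metis Diff_iff IntI insertI1 singletonD subsetD)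
      show "b \<in> insert b (DQ - {q}) - snd ` R"
        using that TQ(2) fR(2) q by (metis Diff_iff IntI insertI1 singletonD subsetD)
    qed (rule max)
  qed
  define hits where "hits b = {x \<in> I. b \<in> V x}" for b
  \<comment> \<open>The vertices of \<open>S\<close> and the left ends freed by swaps hitting
    \<open>b\<close> are all blocked at \<open>b\<close>. They are disjoint because \<open>S\<close>
    meets \<open>DP\<close> only in \<open>p\<close>.\<close>
  have hits_bound: "card S + card (hits b) + n < card F + card T + card R" if b: "b \<in> T" for b
  proof -
    have "S \<inter> \<alpha> ` hits b = {}"
    proof (rule equals0I)
      fix a assume "a \<in> S \<inter> \<alpha> ` hits b"
      then have "a \<in> S" "a \<in> DP - {p}" using \<alpha>D by (auto simp: hits_def)
      then show False using SP(2) by blast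
    qed
    then have "card (S \<union> \<alpha> ` hits b) = card S + card (\<alpha> ` hits b)"
      using fS fI by (intro card_Un_disjoint) (auto simp: hits_def)
    also have "card (\<alpha> ` hits b) = card (hits b)"
      using \<alpha>_inj by (intro card_image) (auto simp: hits_def intro: inj_on_subset)
    finally have "card S + card (hits b) = card (S \<union> \<alpha> ` hits b)" by simp
    also have "\<dots> \<le> card {a \<in> P \<union> X. 2 \<le> card (C a b)} + card R"
    proof (rule column_bound)
      show "b \<in> Q \<union> Y" using b TQ by blast
      show "S \<union> \<alpha> ` hits b \<subseteq> P \<union> X" using SP(1) \<alpha>D sub(1) by (auto simp: hits_def)
      fix a assume "a \<in> S \<union> \<alpha> ` hits b"
      then show "?ok a b" using blockedS[OF _ b] V(2) by (auto simp: hits_def \<alpha>_def)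
    qed (rule R)
    finally show ?thesis using exchange_multi_bound[OF T b] by linarith
  qed

  have qT: "q \<in> T" using TQ by blast
  \<comment> \<open>Members of \<open>S\<close> outside \<open>I\<close> have at least two colours
    on their edge to \<open>q\<close>.\<close>
  have "card S \<le> card (I \<union> {a \<in> P \<union> X. 2 \<le> card (C a q)})"
  proof (rule card_mono)
    show "S \<subseteq> I \<union> {a \<in> P \<union> X. 2 \<le> card (C a q)}"
      using blockedS[OF _ qT] SP by (fastforce simp: I_def)
  qed (use fI fin in auto)
  also have "\<dots> \<le> card I + card {a \<in> P \<union> X. 2 \<le> card (C a q)}" by (rule card_Un_le)
  finally have I_bound: "card S + n < card I + card F + card T"
    using exchange_multi_bound[OF T qT] by linarith

  have cardP: "card P = card Y + card DP" and cardQ: "card Q = card X + card DQ"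
    using saturates_card free fin by blast+
  have cardD: "card DP + card X + card Y = n" "card (Q - DQ) = card X"
    using sides fin disj cardP cardQ sub fD by (simp_all add: card_Un_disjoint card_Diff_subset)
  have "card R = card (fst ` R)" using R by (simp add: light_rainbow_def card_image)
  also have "\<dots> < card DP" using fR p fD by (intro psubset_card_mono) auto
  finally have R_bound: "card R < card DP" .
  have "card S \<le> card (insert p (P - DP))" using SP fin by (intro card_mono) auto
  also have "\<dots> \<le> Suc (card (P - DP))" by (rule card_insert_le_m1) auto
  finally have S_bound: "card S \<le> card Y + 1"
    using cardP sub fD by (simp add: card_Diff_subset)
  have "card T \<le> card (insert q (Q - DQ))" using TQ fin by (intro card_mono) auto
  also have "\<dots> \<le> Suc (card (Q - DQ))" by (rule card_insert_le_m1) auto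
  finally have T_bound: "card T \<le> card X + 1" using cardD by simp

  \<comment> \<open>Inclusion-exclusion: \<open>V x\<close> is large, while \<open>T\<close> and
    \<open>V x\<close> together contain at most two vertices of \<open>DQ\<close>, namely
    \<open>q\<close> and the right end of \<open>e x\<close>.\<close>
  have V_bound: "card T + n + 1 \<le> card F + card X + 2 + card {b \<in> T - {q}. b \<in> V x}"
    if x: "x \<in> I" for x
  proof -
    have VQ: "V x \<subseteq> Q" "V x \<inter> DQ = {snd (e x)}" using V(1)[OF x] by (auto simp: exchange_set_def)
    have fV: "finite (V x)" using VQ fin finite_subset by blast
    have ne: "snd (e x) \<noteq> q" using e x q by force
    then have q_V: "q \<notin> V x" using VQ(2) q by (metis Diff_iff IntI singletonD)
    have "n < card F + card (V x)"
    proof -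
      have "snd (e x) \<in> V x" using VQ(2) by blast
      from exchange_multi_bound[OF V(1)[OF x] this] show ?thesis by linarith
    qed
    moreover have "card T + card (V x) = card (T \<union> V x) + card (T \<inter> V x)"
      using fT fV by (rule card_Un_Int)
    moreover have "card (T \<inter> V x) = card {b \<in> T - {q}. b \<in> V x}"
      using q_V by (intro arg_cong[where f = card]) blast
    moreover have "card (T \<union> V x) \<le> card ((Q - DQ) \<union> {q, snd (e x)})"
      using TQ VQ fin by (intro card_mono) auto
    moreover have "\<dots> \<le> card (Q - DQ) + card {q, snd (e x)}" by (rule card_Un_le)
    moreover have "card {q, snd (e x)} = 2" using ne by simp
    ultimately show ?thesis using cardD by linarith
  qed

  have big_T: "n < card F + card T" using exchange_multi_bound[OF T qT] by linarith
  define D :: int where "D = int n - int (card F) + 1"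
  define K :: int where "K = int (card R) - int (card S) + int (card T) - D"
  define L :: int where "L = int (card T) + D - int (card X) - 2"
  have "4 * int (card F) \<le> 3 * int n" 
    using of_nat_mono[OF few_colours, where 'a = int] by simp
  then have D: "2 \<le> D" "int n \<le> 4 * D - 4" using n_pos unfolding D_def by simp_all
  have K0: "0 \<le> K" using hits_bound[OF qT] by (simp add: K_def D_def)

  \<comment> \<open>Counting pairs \<open>(x, b)\<close> with \<open>b\<close> in both
    \<open>V x\<close> and \<open>T - {q}\<close>: each \<open>x\<close> has at least
    \<open>L\<close> of them, each \<open>b\<close> at most \<open>K\<close>.\<close>
  have "(\<Sum>x\<in>I. card {b \<in> T - {q}. b \<in> V x}) = (\<Sum>b\<in>T - {q}. card (hits b))"
    using fI fT by (intro sum_multicount_gen) (auto simp: hits_def)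
  then have swap: "(\<Sum>x\<in>I. int (card {b \<in> T - {q}. b \<in> V x})) = (\<Sum>b\<in>T - {q}. int (card (hits b)))"
    by (simp only: flip: of_nat_sum)
  have "int (card I) * L = (\<Sum>x\<in>I. L)" by simp
  also have "\<dots> \<le> (\<Sum>x\<in>I. int (card {b \<in> T - {q}. b \<in> V x}))"
  proof (rule sum_mono)
    fix x assume "x \<in> I"
    from V_bound[OF this] show "L \<le> int (card {b \<in> T - {q}. b \<in> V x})"
      by (simp add: L_def D_def)
  qed
  also have "\<dots> \<le> (\<Sum>b\<in>T - {q}. K)" unfolding swap
  proof (rule sum_mono)
    fix b assume "b \<in> T - {q}"
    with hits_bound[of b] show "int (card (hits b)) \<le> K" by (simp add: K_def D_def)
  qed
  also have "\<dots> = (int (card T) - 1) * K"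
    using card.remove[OF fT qT] by simp
  finally have "int (card I) * L \<le> (D + (int (card T) - D) - 1) * K" by simp
  then show False
  proof (rule counting_contradiction[rotated -1])
    \<comment> \<open>The bound on the number of colours enters here: the claim unfolds to
      \<open>card R + card S + card X\<close> being at most \<open>4 * D - 4\<close>. The left side
      is at most \<open>n\<close>, the two off-by-ones for \<open>R\<close> and \<open>S\<close>
      cancelling.\<close>
    show "K + 2 + 2 * (int (card S) - D) \<le> L"
    proof -
      have "card R + card S + card X \<le> n" using R_bound S_bound cardD by linarith
      then have "int (card R) + int (card S) + int (card X) \<le> int n" by linarith
      then show ?thesis using D(2) unfolding K_def L_def by (simp add: algebra_simps)
    qed
    show "D + (int (card S) - D) - (int (card T) - D) \<le> int (card I)"
      using I_bound by (simp add: D_def)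
  qed (use D K0 le big_T T_bound in \<open>auto simp: D_def L_def\<close>)
qed

lemma no_maximal_config:
  assumes cfg: "config DP DQ R" and max: "\<And>DP' DQ' R'. config DP' DQ' R' \<Longrightarrow> card R' \<le> card R"
    and p: "p \<in> DP - fst ` R" and q: "q \<in> DQ - snd ` R"
  shows False
proof -
  have "freeP DP" "freeQ DQ" using cfg by (auto simp: config_def)
  then obtain S T where S: "exchange_set (\<lambda>y a. C a y = {}) Y P DP p S"
    and T: "exchange_set (\<lambda>x b. C x b = {}) X Q DQ q T"
    using exchange_set_exists fin p q by (metis DiffD1)
  show False
  proof (cases "card T \<le> card S")
    case True
    show ?thesis by (rule no_maximal_config_aux[OF cfg max p q S T True])
  next
    case False
    \<comment> \<open>The locale is symmetric in its two sides, so the other case follows by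
      reversing all pairs.\<close>
    interpret flip: covered_colouring Q Y P X "\<lambda>b a. C a b" F n
    proof (rule covered_colouring.intro)
      show "C a b \<noteq> {}" if "b \<in> Q" "a \<in> P" for a b using that(2,1) by (rule cover)
    qed (fact fin disj sides n_pos few_colours C_subset ex1_left ex1_right)+
    have conv: "fst ` (U\<inverse>) = snd ` U" "snd ` (U\<inverse>) = fst ` U" for U :: "('x \<times> 'y) set"
      by force+
    have inj: "inj_on fst (U\<inverse>) = inj_on snd U" "inj_on snd (U\<inverse>) = inj_on fst U"
      for U :: "('x \<times> 'y) set"
      by (auto simp: inj_on_def Ball_def)
    have flip_light_rainbow: "flip.light_rainbow (U\<inverse>) = light_rainbow U" for U
    proof -
      have "(\<forall>(b, a)\<in>U\<inverse>. \<forall>(b', a')\<in>U\<inverse>. C a b \<inter> C a' b' \<noteq> {} \<longrightarrow> (b, a) = (b', a')) \<longleftrightarrow>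
          (\<forall>(a, b)\<in>U. \<forall>(a', b')\<in>U. C a b \<inter> C a' b' \<noteq> {} \<longrightarrow> (a, b) = (a', b'))"
        by fast
      moreover have "(\<forall>(b, a)\<in>U\<inverse>. card (C a b) = 1) \<longleftrightarrow> (\<forall>(a, b)\<in>U. card (C a b) = 1)" by fast
      moreover have "U\<inverse> \<subseteq> Q \<times> P \<longleftrightarrow> U \<subseteq> P \<times> Q" by fast
      ultimately show ?thesis unfolding light_rainbow_def flip.light_rainbow_def inj by argo
    qed
    have flip_config: "flip.config DQ' DP' (U\<inverse>) = config DP' DQ' U" for DP' DQ' U
      unfolding config_def flip.config_def flip_light_rainbow conv by argo
    show ?thesis
    proof (rule flip.no_maximal_config_aux)
      show "flip.config DQ DP (R\<inverse>)" using cfg by (simp only: flip_config)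
      show "card R' \<le> card (R\<inverse>)" if "flip.config DQ' DP' R'" for DQ' DP' R'
        using max[of DP' DQ' "R'\<inverse>"] flip_config[of DQ' DP' "R'\<inverse>"] that by simp
      show "q \<in> DQ - fst ` (R\<inverse>)" "p \<in> DP - snd ` (R\<inverse>)" using p q by (simp_all only: conv)
      show "card S \<le> card T" using False by simp
    qed (fact S T)+
  qed
qed

text \<open>A configuration with largest \<open>R\<close> exists by finiteness. Since
  \<open>DP\<close> and \<open>DQ\<close> have equal size, \<open>R\<close> covers both or misses a
  vertex of each, and the latter is impossible.\<close>

lemma perfect_config:
  assumes "freeP DP\<^sub>0" "freeQ DQ\<^sub>0"
  shows "\<exists>DP DQ R. config DP DQ R \<and> fst ` R = DP \<and> snd ` R = DQ"
proof -
  let ?c = "\<lambda>(DP, DQ, R). config DP DQ R" and ?k = "\<lambda>(DP, DQ, R). card R"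
  have "?c (DP\<^sub>0, DQ\<^sub>0, {})" using assms by (simp add: config_def light_rainbow_def)
  moreover have "\<forall>s. ?c s \<longrightarrow> ?k s < Suc (card (P \<times> Q))"
  proof (intro allI impI)
    fix s assume "?c s"
    obtain DP DQ R where "s = (DP, DQ, R)" by (cases s)
    then have "R \<subseteq> P \<times> Q" "?k s = card R" using \<open>?c s\<close> by (auto simp: config_def light_rainbow_def)
    then show "?k s < Suc (card (P \<times> Q))"
      using fin by (metis card_mono finite_cartesian_product less_Suc_eq_le)
  qed
  ultimately have "\<exists>s. ?c s \<and> (\<forall>s'. ?c s' \<longrightarrow> ?k s' \<le> ?k s)"
    by (rule Lattices_Big.ex_has_greatest_nat)
  then obtain s where s: "?c s" "\<forall>s'. ?c s' \<longrightarrow> ?k s' \<le> ?k s" by (elim exE conjE)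
  obtain DP DQ R where [simp]: "s = (DP, DQ, R)" by (cases s)
  have cfg: "config DP DQ R" using s(1) by simp
  have max: "card R' \<le> card R" if "config DP' DQ' R'" for DP' DQ' R'
    using s(2)[rule_format, of "(DP', DQ', R')"] that by simp
  have R: "inj_on fst R" "inj_on snd R" and fR: "fst ` R \<subseteq> DP" "snd ` R \<subseteq> DQ"
    and free: "freeP DP" "freeQ DQ" and sub: "DP \<subseteq> P" "DQ \<subseteq> Q"
    using cfg by (auto simp: config_def saturates_def light_rainbow_def)
  have fD: "finite DP" "finite DQ" using sub fin finite_subset by blast+
  have "card DP = card DQ"
    using saturates_card[OF free(1) fin(1)] saturates_card[OF free(2) fin(3)] sides fin disj
    by (simp add: card_Un_disjoint)
  moreover have "card (fst ` R) = card R" "card (snd ` R) = card R"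
    using R by (simp_all add: card_image)
  ultimately have "fst ` R = DP \<longleftrightarrow> snd ` R = DQ"
    using fR fD by (metis card_subset_eq)
  moreover have "fst ` R = DP \<or> snd ` R = DQ"
  proof (rule ccontr)
    assume "\<not> ?thesis"
    then obtain p q where "p \<in> DP - fst ` R" "q \<in> DQ - snd ` R" using fR by blast
    then show False by (rule no_maximal_config[OF cfg, rotated]) (rule max)
  qed
  ultimately show ?thesis using cfg by blast
qed

end

section \<open>From perfect matchings of the graph to colours and back\<close>

theorem mainTheorem3:
  fixes n :: nat and G :: "'a graph" and F :: "'a set set set"
  assumes "n > 0"
    and "is_complete_bipartite n n G"
    and "\<forall>N\<in>F. perfect_matching G N"
    and "real (card F) \<le> 3 * real n / 4"
  shows "\<exists>M. perfect_matching G M \<and> light 1 F M \<and> rainbow 1 F M \<and>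
           (\<exists>M\<^sub>0. max_zero_light_matching G F M\<^sub>0 \<and> M\<^sub>0 \<subseteq> M)"
proof -
  obtain A B where fin: "finite A" "finite B" and cards: "card A = n" "card B = n"
    and AB: "A \<inter> B = {}" and verts: "verts G = A \<union> B"
    and edges: "edges G = {{a, b} | a b. a \<in> A \<and> b \<in> B}"
    using assms(2) by (auto simp: is_complete_bipartite_def)
  let ?e = "\<lambda>(a, b). {a, b}"
  have edges': "edges G = ?e ` (A \<times> B)" unfolding edges by auto
  have e_inj: "a = a' \<and> b = b'"
    if "a \<in> A" "a' \<in> A" "b \<in> B" "b' \<in> B" "{a, b} \<inter> {a', b'} \<noteq> {}" "a = a' \<longleftrightarrow> b = b'" for a a' b b'
    using that AB by blast
  have e_eq: "a = a' \<and> b = b'" if "a \<in> A" "a' \<in> A" "b \<in> B" "b' \<in> B" "{a, b} = {a', b'}" for a a' b b'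
    using that AB by (auto simp: doubleton_eq_iff)
  have fE: "finite (edges G)" unfolding edges' using fin by simp
  have "F \<subseteq> Pow (edges G)" using assms(3) by (auto simp: perfect_matching_def matching_def)
  then have fF: "finite F" using fE by (meson finite_Pow_iff finite_subset)
  define C where "C a b = {N \<in> F. {a, b} \<in> N}" for a b
  have disjoint_edges: "e = f" if "N \<in> F" "e \<in> N" "f \<in> N" "v \<in> e" "v \<in> f" for N e f v
    using assms(3) that unfolding perfect_matching_def matching_def by blast
  have edge_at: "\<exists>a\<in>A. \<exists>b\<in>B. {a, b} \<in> N \<and> v \<in> {a, b}" if "N \<in> F" "v \<in> A \<union> B" for N v
  proof -
    have "v \<in> \<Union>N" "N \<subseteq> edges G"
      using assms(3) that verts unfolding perfect_matching_def matching_def by auto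
    then obtain e where "e \<in> N" "v \<in> e" "e \<in> edges G" by blast
    then show ?thesis unfolding edges by auto
  qed
  have ex1_B: "\<exists>!b. b \<in> B \<and> N \<in> C a b" if aN: "a \<in> A" "N \<in> F" for a N
  proof -
    obtain a' b where e: "a' \<in> A" "b \<in> B" "{a', b} \<in> N" "a \<in> {a', b}"
      using edge_at[OF aN(2), of a] aN(1) by blast
    then have "a' = a" using that(1) AB by auto
    then have b: "b \<in> B" "{a, b} \<in> N" using e by auto
    show ?thesis
    proof (rule ex1I[of _ b])
      show "b \<in> B \<and> N \<in> C a b" using b that by (simp add: C_def)
      fix b' assume b': "b' \<in> B \<and> N \<in> C a b'"
      then have "{a, b} = {a, b'}"
        using b(2) by (intro disjoint_edges[of N _ _ a]) (auto simp: C_def)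
      then show "b' = b" by (auto simp: doubleton_eq_iff)
    qed
  qed
  have ex1_A: "\<exists>!a. a \<in> A \<and> N \<in> C a b" if bN: "b \<in> B" "N \<in> F" for b N
  proof -
    obtain a b' where e: "a \<in> A" "b' \<in> B" "{a, b'} \<in> N" "b \<in> {a, b'}"
      using edge_at[OF bN(2), of b] bN(1) by blast
    then have "b' = b" using that(1) AB by auto
    then have a: "a \<in> A" "{a, b} \<in> N" using e by auto
    show ?thesis
    proof (rule ex1I[of _ a])
      show "a \<in> A \<and> N \<in> C a b" using a that by (simp add: C_def)
      fix a' assume a': "a' \<in> A \<and> N \<in> C a' b"
      then have "{a, b} = {a', b}"
        using a(2) by (intro disjoint_edges[of N _ _ b]) (auto simp: C_def)
      then show "a' = a" by (auto simp: doubleton_eq_iff)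
    qed
  qed

  obtain P Y D\<^sub>1 D\<^sub>2 where PA: "P \<subseteq> A" and YB: "Y \<subseteq> B"
    and cover: "\<forall>a\<in>P. \<forall>b\<in>B - Y. C a b \<noteq> {}"
    and free: "saturates (\<lambda>y a. C a y = {}) Y P D\<^sub>1"
      "saturates (\<lambda>x b. C x b = {}) (A - P) (B - Y) D\<^sub>2"
    using koenig_cover[OF fin, of "\<lambda>b a. C a b = {}"] by blast
  define X where "X = A - P"
  define Q where "Q = B - Y"
  have A: "P \<union> X = A" "P \<inter> X = {}" and B: "Q \<union> Y = B" "Q \<inter> Y = {}"
    using PA YB by (auto simp: X_def Q_def)
  have fins: "finite P" "finite X" "finite Q" "finite Y"
    using fin PA YB finite_subset by (auto simp: X_def Q_def)
  interpret covered_colouring P X Q Y C F n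
  proof unfold_locales
    show "C a b \<subseteq> F" for a b by (auto simp: C_def)
    show "4 * card F \<le> 3 * n" using assms(4) by linarith
    show "\<exists>!b. b \<in> Q \<union> Y \<and> c \<in> C a b" if "a \<in> P \<union> X" "c \<in> F" for a c
      using ex1_B that unfolding A B by blast
    show "\<exists>!a. a \<in> P \<union> X \<and> c \<in> C a b" if "b \<in> Q \<union> Y" "c \<in> F" for b c
      using ex1_A that unfolding A B by blast
  qed (use fins fF A B cards assms(1) cover in \<open>auto simp: Q_def\<close>)
  obtain DP DQ R where cfg: "config DP DQ R" and fR: "fst ` R = DP" "snd ` R = DQ"
    using perfect_config free unfolding X_def Q_def by blast
  then have R: "light_rainbow R" and freePQ: "freeP DP" "freeQ DQ" by (simp_all add: config_def)
  obtain h g where h: "bij_betw h Y (P - DP)" "\<forall>y\<in>Y. C (h y) y = {}"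
    and g: "bij_betw g X (Q - DQ)" "\<forall>x\<in>X. C x (g x) = {}" and sub: "DP \<subseteq> P" "DQ \<subseteq> Q"
    using freePQ unfolding saturates_def by (elim conjE exE)
  define Z\<^sub>Y where "Z\<^sub>Y = (\<lambda>y. (h y, y)) ` Y"
  define Z\<^sub>X where "Z\<^sub>X = (\<lambda>x. (x, g x)) ` X"
  have imY: "fst ` Z\<^sub>Y = P - DP" "snd ` Z\<^sub>Y = Y" and imX: "fst ` Z\<^sub>X = X" "snd ` Z\<^sub>X = Q - DQ"
    using h(1) g(1) by (auto simp: Z\<^sub>Y_def Z\<^sub>X_def image_image bij_betw_def)
  have injY: "inj_on fst Z\<^sub>Y" "inj_on snd Z\<^sub>Y" and injX: "inj_on fst Z\<^sub>X" "inj_on snd Z\<^sub>X"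
    using h(1) g(1) by (auto simp: Z\<^sub>Y_def Z\<^sub>X_def bij_betw_def inj_on_def)
  have injR: "inj_on fst R" "inj_on snd R" using R by (simp_all add: light_rainbow_def)
  \<comment> \<open>The pieces cover \<open>P - DP\<close> and \<open>Y\<close>, then
    \<open>X\<close> and \<open>Q - DQ\<close>, then \<open>DP\<close> and \<open>DQ\<close>;
    together they meet every vertex of \<open>A\<close> and of \<open>B\<close> exactly
    once.\<close>
  define Z where "Z = Z\<^sub>Y \<union> Z\<^sub>X \<union> R"
  have imZ: "fst ` Z = A" "snd ` Z = B"
    unfolding Z_def image_Un imY imX fR using A B sub by auto
  have inj_Un: "inj_on f (U \<union> V)" if "inj_on f U" "inj_on f V" "f ` U \<inter> f ` V = {}"
    for f :: "'a \<times> 'a \<Rightarrow> 'a" and U V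
    using that by (auto simp: inj_on_Un)
  have injZ: "inj_on fst Z" "inj_on snd Z" unfolding Z_def
    by (intro inj_Un; use injY injX injR A B sub in \<open>auto simp only: imY imX fR image_Un\<close>; blast)+
  have ZAB: "Z \<subseteq> A \<times> B" using imZ by force
  define M where "M = ?e ` Z"
  define M\<^sub>0 where "M\<^sub>0 = ?e ` (Z\<^sub>Y \<union> Z\<^sub>X)"
  have light_rainbow_eq: "a = a' \<and> b = b'"
    if "(a, b) \<in> R" "(a', b') \<in> R" "N \<in> C a b \<inter> C a' b'" for a b a' b' N
    using that R unfolding light_rainbow_def by fast
  have pair: "\<exists>a b. (a, b) \<in> V \<and> e = {a, b}" if "e \<in> ?e ` V" for e V
  proof -
    obtain z where "z \<in> V" "e = ?e z" using \<open>e \<in> ?e ` V\<close> by (elim imageE)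
    then show ?thesis by (intro exI[of _ "fst z"] exI[of _ "snd z"]) (simp add: case_prod_beta)
  qed
  have M_disj: "e = f" if ef: "e \<in> M" "f \<in> M" "e \<inter> f \<noteq> {}" for e f
  proof -
    obtain a b a' b' where z: "(a, b) \<in> Z" "(a', b') \<in> Z" "e = {a, b}" "f = {a', b'}"
      using pair ef(1,2) unfolding M_def by metis
    have "a = a' \<longleftrightarrow> b = b'" using injZ z(1,2) by (metis fst_conv inj_onD snd_conv)
    then show ?thesis using e_inj[of a a' b b'] z ZAB ef(3) by blast
  qed
  have "M \<subseteq> edges G" unfolding M_def edges' using ZAB by (rule image_mono)
  then have "matching G M" unfolding matching_def by (meson M_disj)
  moreover have "\<Union>M = A \<union> B"
  proof -
    have "\<Union>M = (\<Union>z\<in>Z. {fst z} \<union> {snd z})" 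
      by (simp add: M_def case_prod_beta insert_commute)
    also have "\<dots> = fst ` Z \<union> snd ` Z" by (simp only: UN_Un_distrib UNION_singleton_eq_range)
    finally have "\<Union>M = fst ` Z \<union> snd ` Z" .
    then show ?thesis by (simp only: imZ)
  qed
  ultimately have perfect: "perfect_matching G M" by (simp add: perfect_matching_def verts)

  have colourless: "C a b = {}" if "(a, b) \<in> Z\<^sub>Y \<union> Z\<^sub>X" for a b
    using that h(2) g(2) by (auto simp: Z\<^sub>Y_def Z\<^sub>X_def)
  have light: "light 1 F M" unfolding light_def
  proof
    fix e assume "e \<in> M"
    then obtain a b where z: "(a, b) \<in> Z" "e = {a, b}" using pair unfolding M_def by metis
    have "card (C a b) \<le> 1"
    proof (cases "(a, b) \<in> R")
      case True
      then show ?thesis using R by (auto simp: light_rainbow_def)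
    next
      case False
      then have "(a, b) \<in> Z\<^sub>Y \<union> Z\<^sub>X" using z(1) unfolding Z_def by (meson UnE)
      from colourless[OF this] show ?thesis by simp
    qed
    then show "card {N \<in> F. e \<in> N} \<le> 1" by (simp add: C_def z(2))
  qed
  have rainbow: "rainbow 1 F M" unfolding rainbow_def
  proof
    fix N assume N: "N \<in> F"
    have "e = f" if ef: "e \<in> N \<inter> M" "f \<in> N \<inter> M" for e f
    proof -
      have "e \<in> ?e ` Z" "f \<in> ?e ` Z" using ef by (simp_all only: M_def Int_iff)
      from this[THEN pair] obtain a b a' b'
        where z: "(a, b) \<in> Z" "(a', b') \<in> Z" "e = {a, b}" "f = {a', b'}" by (elim exE conjE)
      then have "N \<in> C a b \<inter> C a' b'" using ef N by (simp add: C_def)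
      \<comment> \<open>Edges outside \<open>R\<close> are colourless, so a colour shared by two
        edges of \<open>M\<close> is shared inside \<open>R\<close>.\<close>
      moreover from this have "(a, b) \<in> R" "(a', b') \<in> R"
        using z(1,2) colourless[of a b] colourless[of a' b'] unfolding Z_def
        by (metis IntE UnE empty_iff)+
      ultimately show ?thesis using z(3,4) light_rainbow_eq by blast
    qed
    moreover have "finite (N \<inter> M)" using \<open>M \<subseteq> edges G\<close> fE finite_subset by blast
    ultimately show "card (N \<inter> M) \<le> 1" by (simp add: card_le_Suc0_iff_eq)
  qed

  have "M\<^sub>0 \<subseteq> M" unfolding M\<^sub>0_def M_def Z_def by (intro image_mono) simp
  moreover from this have "matching G M\<^sub>0"
    using \<open>matching G M\<close> unfolding matching_def by (meson subset_iff)
  moreover have "light 0 F M\<^sub>0" unfolding light_def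
  proof
    fix e assume "e \<in> M\<^sub>0"
    then obtain a b where z: "(a, b) \<in> Z\<^sub>Y \<union> Z\<^sub>X" "e = {a, b}"
      using pair unfolding M\<^sub>0_def by metis
    have "{N \<in> F. e \<in> N} = {}" using colourless[OF z(1)] unfolding C_def z(2) .
    then show "card {N \<in> F. e \<in> N} \<le> 0" by (simp only: card.empty order_refl)
  qed
  \<comment> \<open>Weak duality: each edge of a colourless matching picks its own vertex of the
    cover, and \<open>M\<^sub>0\<close> has as many edges as the cover has vertices.\<close>
  moreover have "card M' \<le> card M\<^sub>0" if M': "matching G M'" "light 0 F M'" for M'
  proof -
    have "\<exists>v. v \<in> e \<inter> (X \<union> Y)" if e: "e \<in> M'" for e
    proof -
      obtain a b where ab: "a \<in> A" "b \<in> B" "e = {a, b}"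
        using e M'(1) unfolding matching_def edges by blast
      have "C a b = {}" using e M'(2) fF ab by (auto simp: light_def C_def)
      then have "a \<in> X \<or> b \<in> Y" using ab cover[of a b] by (auto simp: X_def Q_def)
      then show ?thesis using ab(3) by blast
    qed
    then obtain v where v: "\<And>e. e \<in> M' \<Longrightarrow> v e \<in> e \<inter> (X \<union> Y)" by metis
    have "inj_on v M'" using M'(1) v unfolding inj_on_def matching_def by (metis IntD1 disjoint_iff)
    then have "card M' \<le> card (X \<union> Y)" using v fins by (intro card_inj_on_le) auto
    also have "X \<inter> Y = {}" using A B AB by blast
    then have "card (X \<union> Y) = card X + card Y" using fins by (simp add: card_Un_disjoint)
    also have "card X = card Z\<^sub>X" using card_image[OF injX(1)] imX by simp
    also have "card Y = card Z\<^sub>Y" using card_image[OF injY(2)] imY by simp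
    also have "card Z\<^sub>X + card Z\<^sub>Y = card (Z\<^sub>Y \<union> Z\<^sub>X)"
    proof -
      have "Z\<^sub>Y \<inter> Z\<^sub>X = {}" using imY(2) imX(2) B(2)
        by (metis DiffD1 disjoint_iff image_eqI)
      then show ?thesis using fins by (simp add: card_Un_disjoint Z\<^sub>Y_def Z\<^sub>X_def)
    qed
    also have "\<dots> = card M\<^sub>0" unfolding M\<^sub>0_def
    proof (rule card_image[symmetric], rule inj_onI)
      fix z z' assume "z \<in> Z\<^sub>Y \<union> Z\<^sub>X" "z' \<in> Z\<^sub>Y \<union> Z\<^sub>X" "?e z = ?e z'"
      moreover from this have "z \<in> A \<times> B" "z' \<in> A \<times> B" using ZAB Z_def by blast+
      ultimately show "z = z'" using e_eq by auto
    qed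
    finally show ?thesis .
  qed
  ultimately show ?thesis
    using perfect light rainbow unfolding max_zero_light_matching_def by blast
qed

end
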